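(* Let $\mathcal{G}$ be a connected metric graph with vertex set $\mathsf{V}$ and let $\alpha\in[0,\infty)^{\mathsf{V}}$ be not identically zero. Let $\mathsf{v}_1,\mathsf{v}_2\in\mathsf{V}$ with $\mathsf{v}_1\neq\mathsf{v}_2$, with strengths $\alpha_{\mathsf{v}_1},\alpha_{\mathsf{v}_2}$ respectively. Denote by $\tilde{\mathcal{G}}$ the metric graph obtained from $\mathcal{G}$ by joining $\mathsf{v}_1$ and $\mathsf{v}_2$ to form one single vertex $\mathsf{v}_0$ (all edges and edge lengths being kept), and let $\tilde\alpha\in[0,\infty)^{(\mathsf{V}\cup\{\mathsf{v}_0\})\setminus\{\mathsf{v}_1,\mathsf{v}_2\}}$ be defined by $\tilde\alpha_{\mathsf{v}_0}=\alpha_{\mathsf{v}_1}+\alpha_{\mathsf{v}_2}$ and $\tilde\alpha_{\mathsf{v}}=\alpha_{\mathsf{v}}$ for $\mathsf{v}\neq\mathsf{v}_0$. Then $T(\mathcal{G},\alpha)\geq T(\tilde{\mathcal{G}},\tilde\alpha)$.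
   Context: A metric graph $\mathcal{G}$ is a finite collection of intervals glued together at their endpoints according to a finite combinatorial graph $(\mathsf{V},\mathsf{E})$ (loops and multiple edges allowed); each edge $\mathsf{e}\in\mathsf{E}$ is identified with $[0,\ell_{\mathsf{e}}]$, $\ell_{\mathsf{e}}\in(0,\infty)$. It is connected if any two points are joined by a continuous path. $\mathsf{E}_{\mathsf{v}}$ is the collection of edges incident to $\mathsf{v}$ (a loop at $\mathsf{v}$ counted twice, once for each endpoint), $u_{\mathsf{e}}$ is the restriction of $u$ to $\mathsf{e}$, and $\frac{\partial u_{\mathsf{e}}}{\partial n}(\mathsf{v})$ is the derivative of $u_{\mathsf{e}}$ at the endpoint $\mathsf{v}$ in the direction pointing into $\mathsf{v}$. For $\alpha\in\mathbb{R}^{\mathsf{V}}$ (the strengths), the operator $-\Delta_{\mathcal{G},\alpha}$ in $L^2(\mathcal{G})$ acts as $u\mapsto -u''$ on each edge, on functions that are edgewise in $H^2(0,\ell_{\mathsf{e}})$, continuous at every vertex, and satisfy $\sum_{\mathsf{e}\in\mathsf{E}_{\mathsf{v}}}\frac{\partial u_{\mathsf{e}}}{\partial n}(\mathsf{v})+\alpha_{\mathsf{v}}u(\mathsf{v})=0$ for all $\mathsf{v}\in\mathsf{V}$. The torsion function of $(\mathcal{G},\alpha)$ is the unique solution $\upsilon$ of $-\Delta_{\mathcal{G},\alpha}\upsilon=1$ (it exists and is strictly positive when $\mathcal{G}$ is connected and $\alpha\in[0,\infty)^{\mathsf{V}}$ is not identically zero), and the torsional rigidity is $T(\mathcal{G},\alpha)=\int_{\mathcal{G}}\upsilon(x)\,\mathrm{d}x$.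 *)

theory Defs
  imports "HOL-Analysis.Analysis" "Graph_Theory.Digraph"
begin

section \<open>Metric graphs\<close>

text \<open>
  The combinatorial graph is a finite multigraph with loops. The direction of an edge \<open>e\<close> only
  records its identification with \<open>[0, len e]\<close>: its tail is the endpoint \<open>0\<close> and its head the
  endpoint \<open>len e\<close>.
\<close>

locale metric_graph = fin_digraph G for G :: "('v, 'e) pre_digraph" +
  fixes len :: "'e \<Rightarrow> real"
  assumes len_pos: "e \<in> arcs G \<Longrightarrow> 0 < len e"

text \<open>
  A point of the metric graph is a vertex \<open>Inl v\<close> or an interior point \<open>Inr (e, x)\<close> of an edge.
  The map \<open>edge_point G len e\<close> is the gluing map from \<open>[0, len e]\<close> into the metric graph, so that
  \<open>u \<circ> edge_point G len e\<close> is the restriction of a function \<open>u\<close> to the edge \<open>e\<close>.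
\<close>

definition edge_point :: "('v, 'e) pre_digraph \<Rightarrow> ('e \<Rightarrow> real) \<Rightarrow> 'e \<Rightarrow> real \<Rightarrow> 'v + 'e \<times> real" where
  "edge_point G len e x =
     (if x = 0 then Inl (tail G e) else if x = len e then Inl (head G e) else Inr (e, x))"

definition mg_points :: "('v, 'e) pre_digraph \<Rightarrow> ('e \<Rightarrow> real) \<Rightarrow> ('v + 'e \<times> real) set" where
  "mg_points G len = Inl ` verts G \<union> (\<Union>e\<in>arcs G. edge_point G len e ` {0..len e})"

text \<open>The quotient topology: the finest one making all gluing maps continuous.\<close>

definition mg_topology ::
    "('v, 'e) pre_digraph \<Rightarrow> ('e \<Rightarrow> real) \<Rightarrow> ('v + 'e \<times> real) topology" where
  "mg_topology G len = topology (\<lambda>U. U \<subseteq> mg_points G len \<and>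
     (\<forall>e\<in>arcs G. openin (top_of_set {0..len e}) {x \<in> {0..len e}. edge_point G len e x \<in> U}))"

lemma openin_mg_topology:
  "openin (mg_topology G len) U \<longleftrightarrow> U \<subseteq> mg_points G len \<and>
     (\<forall>e\<in>arcs G. openin (top_of_set {0..len e}) {x \<in> {0..len e}. edge_point G len e x \<in> U})"
proof -
  let ?L = "\<lambda>U. U \<subseteq> mg_points G len \<and>
     (\<forall>e\<in>arcs G. openin (top_of_set {0..len e}) {x \<in> {0..len e}. edge_point G len e x \<in> U})"
  have 1: "?L (S \<inter> T)" if "?L S" "?L T" for S T
  proof -
    have "{x \<in> {0..len e}. edge_point G len e x \<in> S \<inter> T} =
      {x \<in> {0..len e}. edge_point G len e x \<in> S} \<inter> {x \<in> {0..len e}. edge_point G len e x \<in> T}" for e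
      by auto
    then show ?thesis using that by (auto intro: openin_Int)
  qed
  have 2: "?L (\<Union>\<K>)" if "\<forall>K\<in>\<K>. ?L K" for \<K>
  proof -
    have "{x \<in> {0..len e}. edge_point G len e x \<in> \<Union>\<K>} =
      (\<Union>K\<in>\<K>. {x \<in> {0..len e}. edge_point G len e x \<in> K})" for e
      by auto
    then show ?thesis using that by (auto intro: openin_clauses(3))
  qed
  have "istopology ?L"
    unfolding istopology_def using 1 2 by blast
  then show ?thesis
    by (simp add: mg_topology_def topology_inverse')
qed

lemma topspace_mg_topology: "topspace (mg_topology G len) = mg_points G len"
proof -
  have "{x \<in> {0..len e}. edge_point G len e x \<in> mg_points G len} = {0..len e}"
    if "e \<in> arcs G" for e
    using that by (auto simp: mg_points_def)
  then have "openin (mg_topology G len) (mg_points G len)"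
    by (simp add: openin_mg_topology)
  then show ?thesis
    by (meson openin_mg_topology openin_subset openin_topspace subset_antisym)
qed

definition mg_connected :: "('v, 'e) pre_digraph \<Rightarrow> ('e \<Rightarrow> real) \<Rightarrow> bool" where
  "mg_connected G len \<longleftrightarrow> path_connected_space (mg_topology G len)"


section \<open>The Sobolev space \<open>H\<^sup>2\<close> of a bounded interval\<close>

definition L2_interval :: "real \<Rightarrow> (real \<Rightarrow> real) \<Rightarrow> bool" where
  "L2_interval l f \<longleftrightarrow> f \<in> borel_measurable (lebesgue_on {0<..<l}) \<and>
     integrable (lebesgue_on {0<..<l}) (\<lambda>x. (f x)\<^sup>2)"

text \<open>
  As in Brezis' textbook on Sobolev spaces, the test functions are the compactly supported \<open>C\<^sup>1\<close>
  functions on \<open>(0, l)\<close>; this gives the same weak derivatives as smooth test functions.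
\<close>

definition test_function :: "real \<Rightarrow> (real \<Rightarrow> real) \<Rightarrow> bool" where
  "test_function l \<phi> \<longleftrightarrow> \<phi> C1_differentiable_on UNIV \<and> closure {x. \<phi> x \<noteq> 0} \<subseteq> {0<..<l}"

definition weak_derivative :: "real \<Rightarrow> (real \<Rightarrow> real) \<Rightarrow> (real \<Rightarrow> real) \<Rightarrow> bool" where
  "weak_derivative l f g \<longleftrightarrow> (\<forall>\<phi>. test_function l \<phi> \<longrightarrow>
     (LINT x|lebesgue_on {0<..<l}. f x * deriv \<phi> x) = - (LINT x|lebesgue_on {0<..<l}. g x * \<phi> x))"

text \<open>
  The relation "\<open>f \<in> H\<^sup>2(0, l)\<close> and \<open>f'' = h\<close> in \<open>L\<^sup>2(0, l)\<close>".
\<close>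

definition H2_second_derivative :: "real \<Rightarrow> (real \<Rightarrow> real) \<Rightarrow> (real \<Rightarrow> real) \<Rightarrow> bool" where
  "H2_second_derivative l f h \<longleftrightarrow> L2_interval l f \<and> L2_interval l h \<and>
     (\<exists>g. L2_interval l g \<and> weak_derivative l f g \<and> weak_derivative l g h)"

definition H2_interval :: "real \<Rightarrow> (real \<Rightarrow> real) \<Rightarrow> bool" where
  "H2_interval l f \<longleftrightarrow> (\<exists>h. H2_second_derivative l f h)"


section \<open>The Laplacian with vertex strengths\<close>

text \<open>
  The sum over the edge ends at \<open>v\<close> of the derivatives in the direction pointing into \<open>v\<close>.
  A loop at \<open>v\<close> contributes to both sums. The one-sided derivatives exist for continuous
  functions that are edgewise in \<open>H\<^sup>2\<close>, since \<open>H\<^sup>2(0, l)\<close> embeds into \<open>C\<^sup>1[0, l]\<close>.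
\<close>

definition normal_derivative_sum ::
    "('v, 'e) pre_digraph \<Rightarrow> ('e \<Rightarrow> real) \<Rightarrow> ('v + 'e \<times> real \<Rightarrow> real) \<Rightarrow> 'v \<Rightarrow> real" where
  "normal_derivative_sum G len u v =
     (\<Sum>e\<in>in_arcs G v. vector_derivative (u \<circ> edge_point G len e) (at (len e) within {0..len e})) +
     (\<Sum>e\<in>out_arcs G v. - vector_derivative (u \<circ> edge_point G len e) (at 0 within {0..len e}))"

text \<open>
  An element of the operator domain is given by its continuous representative, a function on the
  points of the metric graph.
\<close>

definition laplacian_domain ::
    "('v, 'e) pre_digraph \<Rightarrow> ('e \<Rightarrow> real) \<Rightarrow> ('v \<Rightarrow> real) \<Rightarrow> ('v + 'e \<times> real \<Rightarrow> real) set" where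
  "laplacian_domain G len \<alpha> = {u.
     (\<forall>e\<in>arcs G. H2_interval (len e) (u \<circ> edge_point G len e)) \<and>
     continuous_map (mg_topology G len) euclideanreal u \<and>
     (\<forall>v\<in>verts G. normal_derivative_sum G len u v + \<alpha> v * u (Inl v) = 0)}"

text \<open>The graph of the operator: \<open>u\<close> lies in the domain and is mapped to \<open>f\<close>, i.e. \<open>- u'' = f\<close>
  on each edge.\<close>

definition neg_laplacian ::
    "('v, 'e) pre_digraph \<Rightarrow> ('e \<Rightarrow> real) \<Rightarrow> ('v \<Rightarrow> real) \<Rightarrow>
     ('v + 'e \<times> real \<Rightarrow> real) \<Rightarrow> ('v + 'e \<times> real \<Rightarrow> real) \<Rightarrow> bool" where
  "neg_laplacian G len \<alpha> u f \<longleftrightarrow> u \<in> laplacian_domain G len \<alpha> \<and>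
     (\<forall>e\<in>arcs G. H2_second_derivative (len e) (u \<circ> edge_point G len e)
        (\<lambda>x. - f (edge_point G len e x)))"

text \<open>Extensionality fixes the irrelevant values outside the metric graph, which makes the
  solution unique as a HOL function.\<close>

definition torsion_function ::
    "('v, 'e) pre_digraph \<Rightarrow> ('e \<Rightarrow> real) \<Rightarrow> ('v \<Rightarrow> real) \<Rightarrow> 'v + 'e \<times> real \<Rightarrow> real" where
  "torsion_function G len \<alpha> =
     (THE u. u \<in> extensional (mg_points G len) \<and> neg_laplacian G len \<alpha> u (\<lambda>_. 1))"

definition mg_integral ::
    "('v, 'e) pre_digraph \<Rightarrow> ('e \<Rightarrow> real) \<Rightarrow> ('v + 'e \<times> real \<Rightarrow> real) \<Rightarrow> real" where
  "mg_integral G len u = (\<Sum>e\<in>arcs G. LINT x|lebesgue_on {0..len e}. u (edge_point G len e x))"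

definition torsional_rigidity ::
    "('v, 'e) pre_digraph \<Rightarrow> ('e \<Rightarrow> real) \<Rightarrow> ('v \<Rightarrow> real) \<Rightarrow> real" where
  "torsional_rigidity G len \<alpha> = mg_integral G len (torsion_function G len \<alpha>)"


section \<open>Joining two vertices\<close>

definition join_vertices :: "'v \<Rightarrow> 'v \<Rightarrow> 'v \<Rightarrow> ('v, 'e) pre_digraph \<Rightarrow> ('v, 'e) pre_digraph" where
  "join_vertices v1 v2 v0 G =
     (let q = (\<lambda>v. if v \<in> {v1, v2} then v0 else v)
      in \<lparr>verts = q ` verts G, arcs = arcs G, tail = q \<circ> tail G, head = q \<circ> head G\<rparr>)"

end

theory Submission
  imports Defs
begin

text \<open>
  On an edge of length \<open>l\<close> the equation \<open>- u'' = 1\<close> makes \<open>u\<close> the quadratic polynomial determined by its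
  two endpoint values. The vertex conditions thus become a linear system for the vertex values \<open>U\<close>,
  whose weak form is \<open>E(U, w) = \<langle>b, w\<rangle>\<close> for all \<open>w\<close>, where \<open>E(U, U)\<close> is the discrete energy
  \<open>\<Sum>\<^sub>e (U(head e) - U(tail e))\<^sup>2 / l\<^sub>e + \<Sum>\<^sub>v \<alpha>\<^sub>v U(v)\<^sup>2\<close> and
  \<open>\<langle>b, w\<rangle> = \<Sum>\<^sub>e l\<^sub>e / 2 (w(tail e) + w(head e))\<close>; moreover the torsional rigidity is
  \<open>\<Sum>\<^sub>e l\<^sub>e\<^sup>3 / 12 + \<langle>b, U\<rangle>\<close>. The solution on the joined graph pulls back to a function \<open>W\<close> on the
  original vertices with \<open>E(W, W) = \<langle>b, W\<rangle>\<close>, and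
  \<open>0 \<le> E(U - W, U - W) = \<langle>b, U\<rangle> - 2 \<langle>b, W\<rangle> + \<langle>b, W\<rangle>\<close> is the claim.
\<close>

section \<open>Weak derivatives on an interval\<close>

abbreviation intv :: "real \<Rightarrow> real measure" where
  "intv l \<equiv> lebesgue_on {0<..<l}"

lemma integrable_interval_continuous:
  fixes f :: "real \<Rightarrow> real"
  assumes "continuous_on {0..l} f"
  shows "integrable (intv l) f"
proof -
  have "f absolutely_integrable_on {0<..<l}"
    using absolutely_integrable_continuous_real[OF assms]
    by (rule set_integrable_subset) auto
  then show ?thesis
    by (rule absolutely_integrable_imp_integrable) simp
qed

lemma LINT_interval_continuous:
  fixes f :: "real \<Rightarrow> real"
  assumes "continuous_on {0..l} f"
  shows "(LINT x|intv l. f x) = integral {0..l} f"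
  using lebesgue_integral_eq_integral[OF integrable_interval_continuous[OF assms]]
  by (simp add: integral_open_interval_real)

lemma LINT_interval_derivative:
  fixes F D :: "real \<Rightarrow> real"
  assumes "0 \<le> l" and "continuous_on {0..l} D"
    and "\<And>x. x \<in> {0..l} \<Longrightarrow> (F has_vector_derivative D x) (at x within {0..l})"
  shows "(LINT x|intv l. D x) = F l - F 0"
  using fundamental_theorem_of_calculus[OF assms(1,3)] LINT_interval_continuous[OF assms(2)]
  by (simp add: integral_unique)

lemma L2_interval_continuous:
  fixes f :: "real \<Rightarrow> real"
  assumes "continuous_on {0..l} f"
  shows "L2_interval l f"
proof -
  have "continuous_on {0..l} (\<lambda>x. (f x)\<^sup>2)"
    using assms by (intro continuous_intros)
  from integrable_interval_continuous[OF this] integrable_interval_continuous[OF assms]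
  show ?thesis by (auto simp: L2_interval_def)
qed

text \<open>Dominated by the sum of the squares, since |a b| <= a^2 + b^2. This makes every pairing
  of an L2 function with a test function or its derivative integrable, so that pairings can be split
  linearly.\<close>

lemma L2_interval_integrable_mult:
  assumes "L2_interval l f" and "L2_interval l g"
  shows "integrable (intv l) (\<lambda>x. f x * g x)"
proof (rule Bochner_Integration.integrable_bound)
  show "integrable (intv l) (\<lambda>x. (f x)\<^sup>2 + (g x)\<^sup>2)"
    using assms by (auto simp: L2_interval_def)
  show "(\<lambda>x. f x * g x) \<in> borel_measurable (intv l)"
    using assms by (auto simp: L2_interval_def)
  have "\<bar>a * b\<bar> \<le> \<bar>a\<^sup>2 + b\<^sup>2\<bar>" for a b :: real
  proof -
    have "2 * (\<bar>a\<bar> * \<bar>b\<bar>) \<le> a\<^sup>2 + b\<^sup>2"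
      using zero_le_power2[of "\<bar>a\<bar> - \<bar>b\<bar>"] by (simp add: power2_eq_square algebra_simps)
    moreover have "0 \<le> \<bar>a\<bar> * \<bar>b\<bar>" by simp
    ultimately have "\<bar>a\<bar> * \<bar>b\<bar> \<le> a\<^sup>2 + b\<^sup>2" by linarith
    then show ?thesis by (simp add: abs_mult)
  qed
  then show "AE x in intv l. norm (f x * g x) \<le> norm ((f x)\<^sup>2 + (g x)\<^sup>2)"
    by simp
qed

lemma L2_interval_add:
  assumes "L2_interval l f" and "L2_interval l g"
  shows "L2_interval l (\<lambda>x. f x + g x)"
proof -
  have "integrable (intv l) (\<lambda>x. (f x)\<^sup>2 + (g x)\<^sup>2 + 2 * (f x * g x))"
    using assms L2_interval_integrable_mult[OF assms]
    by (simp add: L2_interval_def)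
  moreover have "(\<lambda>x. (f x)\<^sup>2 + (g x)\<^sup>2 + 2 * (f x * g x)) = (\<lambda>x. (f x + g x)\<^sup>2)"
    by (auto simp: power2_eq_square algebra_simps)
  ultimately show ?thesis
    using assms by (auto simp: L2_interval_def)
qed

section \<open>Test functions: supports, integration by parts, primitives and bumps\<close>

lemma test_function_support:
  assumes "test_function l \<phi>" and "0 < l"
  obtains s t where "0 < s" "s \<le> t" "t < l" "\<And>x. x \<notin> {s..t} \<Longrightarrow> \<phi> x = 0"
proof (cases "{x. \<phi> x \<noteq> 0} = {}")
  case True
  \<comment> \<open>The zero function has empty support, so any interval inside (0, l) will
    do.\<close>
  then show ?thesis using assms that[of "l/2" "l/2"] by auto
next
  case False
  define K where "K = closure {x. \<phi> x \<noteq> 0}"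
  have K: "K \<subseteq> {0<..<l}" using assms by (simp add: test_function_def K_def)
  then have "compact K"
    unfolding compact_eq_bounded_closed using bounded_subset[OF bounded_Ioo] by (simp add: K_def)
  moreover have "K \<noteq> {}" using False by (simp add: K_def)
  ultimately obtain s t where st: "s \<in> K" "t \<in> K" "\<And>x. x \<in> K \<Longrightarrow> s \<le> x \<and> x \<le> t"
    using compact_attains_inf[of K] compact_attains_sup[of K] by blast
  have "\<phi> x = 0" if "x \<notin> {s..t}" for x
  proof (rule ccontr)
    assume "\<phi> x \<noteq> 0"
    then have "x \<in> K" using closure_subset[of "{x. \<phi> x \<noteq> 0}"] unfolding K_def by blast
    with st(3) that show False by auto
  qed
  then show ?thesis
    using st K by (intro that[of s t]) auto
qed

lemma test_functionI:
  assumes "\<And>x. (\<phi> has_vector_derivative D x) (at x)" and "continuous_on UNIV D"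
    and "0 < s" and "t < l" and "\<And>x. x \<notin> {s..t} \<Longrightarrow> \<phi> x = 0"
  shows "test_function l \<phi>" and "deriv \<phi> = D"
proof -
  have "closure {x. \<phi> x \<noteq> 0} \<subseteq> {s..t}"
    using assms(5) by (intro closure_minimal) (blast, simp)
  then have "closure {x. \<phi> x \<noteq> 0} \<subseteq> {0<..<l}"
    using assms(3,4) by auto
  then show "test_function l \<phi>"
    using assms(1,2) by (auto simp: test_function_def C1_differentiable_on_def)
  show "deriv \<phi> = D"
    using assms(1) by (auto intro!: ext DERIV_imp_deriv simp: has_real_derivative_iff_has_vector_derivative)
qed

lemma
  assumes "test_function l \<phi>"
  shows test_function_has_deriv: "(\<phi> has_vector_derivative deriv \<phi> x) (at x within S)"
    and test_function_continuous: "continuous_on S \<phi>"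
    and test_function_continuous_deriv: "continuous_on S (deriv \<phi>)"
    and test_function_zero: "\<phi> 0 = 0"
    and test_function_end: "\<phi> l = 0"
proof -
  obtain D where D: "\<And>x. (\<phi> has_vector_derivative D x) (at x)" "continuous_on UNIV D"
    using assms by (auto simp: test_function_def C1_differentiable_on_def)
  have [simp]: "deriv \<phi> = D"
    using D(1) by (auto intro!: ext DERIV_imp_deriv simp: has_real_derivative_iff_has_vector_derivative)
  show "(\<phi> has_vector_derivative deriv \<phi> x) (at x within S)"
    using D(1) by (simp add: has_vector_derivative_at_within)
  show "continuous_on S (deriv \<phi>)"
    using D(2) by (auto intro: continuous_on_subset)
  show "continuous_on S \<phi>"
    unfolding continuous_on_eq_continuous_within
    using has_vector_derivative_continuous[OF has_vector_derivative_at_within[OF D(1)]] by blast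
  have "closure {x. \<phi> x \<noteq> 0} \<subseteq> {0<..<l}"
    using assms by (simp add: test_function_def)
  then have "{x. \<phi> x \<noteq> 0} \<subseteq> {0<..<l}"
    by (rule order_trans[OF closure_subset])
  then show "\<phi> 0 = 0" "\<phi> l = 0" by auto
qed

lemma L2_interval_test_function:
  assumes "test_function l \<phi>"
  shows "L2_interval l \<phi>" and "L2_interval l (deriv \<phi>)"
  by (rule L2_interval_continuous[OF test_function_continuous[OF assms]],
      rule L2_interval_continuous[OF test_function_continuous_deriv[OF assms]])

text \<open>Integration by parts: the fundamental theorem applied to \<open>F * \<phi>\<close>,
  whose boundary terms vanish because \<open>\<phi>\<close> is zero at both ends.\<close>

lemma weak_derivative_C1:
  fixes F D :: "real \<Rightarrow> real"
  assumes "0 \<le> l" and "continuous_on {0..l} D"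
    and F: "\<And>x. x \<in> {0..l} \<Longrightarrow> (F has_vector_derivative D x) (at x within {0..l})"
  shows "weak_derivative l F D"
  unfolding weak_derivative_def
proof (intro allI impI)
  fix \<phi> assume \<phi>: "test_function l \<phi>"
  have cF: "continuous_on {0..l} F"
    unfolding continuous_on_eq_continuous_within
    using has_vector_derivative_continuous[OF F] by blast
  note tc = test_function_continuous[OF \<phi>] test_function_continuous_deriv[OF \<phi>]
  have "(LINT x|intv l. F x * deriv \<phi> x + D x * \<phi> x) = F l * \<phi> l - F 0 * \<phi> 0"
  proof (rule LINT_interval_derivative)
    show "continuous_on {0..l} (\<lambda>x. F x * deriv \<phi> x + D x * \<phi> x)"
      by (intro continuous_intros cF assms tc)
    show "((\<lambda>x. F x * \<phi> x) has_vector_derivative F x * deriv \<phi> x + D x * \<phi> x) (at x within {0..l})"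
      if "x \<in> {0..l}" for x
      using has_vector_derivative_mult[OF F[OF that] test_function_has_deriv[OF \<phi>]] .
  qed fact
  moreover have "(LINT x|intv l. F x * deriv \<phi> x + D x * \<phi> x)
     = (LINT x|intv l. F x * deriv \<phi> x) + (LINT x|intv l. D x * \<phi> x)"
    by (intro Bochner_Integration.integral_add integrable_interval_continuous continuous_intros cF assms tc)
  ultimately show "(LINT x|intv l. F x * deriv \<phi> x) = - (LINT x|intv l. D x * \<phi> x)"
    by (simp add: test_function_zero[OF \<phi>] test_function_end[OF \<phi>])
qed

text \<open>The primitive vanishing at 0 is constant on each side of the support of
  \<open>\<eta>\<close>. The left constant is its value at 0, the right one is its value at
  \<open>l\<close>, which is the integral of \<open>\<eta>\<close>; so both are zero.\<close>

lemma test_function_primitive: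
  assumes "0 < l" and \<eta>: "test_function l \<eta>" and int0: "(LINT x|intv l. \<eta> x) = 0"
  obtains \<Phi> where "test_function l \<Phi>" "deriv \<Phi> = \<eta>"
proof -
  obtain s t where st: "0 < s" "s \<le> t" "t < l" "\<And>x. x \<notin> {s..t} \<Longrightarrow> \<eta> x = 0"
    using test_function_support[OF \<eta> \<open>0 < l\<close>] by blast
  have c\<eta>: "continuous_on UNIV \<eta>" by (rule test_function_continuous[OF \<eta>])
  then have "\<exists>F. \<forall>x::real. -\<infinity> < ereal x \<longrightarrow> ereal x < \<infinity> \<longrightarrow> (F has_vector_derivative \<eta> x) (at x)"
    by (intro einterval_antiderivative) (auto simp: continuous_on_eq_continuous_at)
  then obtain F where F: "\<And>x. (F has_vector_derivative \<eta> x) (at x)" by auto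
  define \<Phi> where "\<Phi> x = F x - F 0" for x
  have \<Phi>: "(\<Phi> has_vector_derivative \<eta> x) (at x)" for x
    unfolding \<Phi>_def using has_vector_derivative_diff[OF F[of x] has_vector_derivative_const[of "F 0"]] by simp
  have const: "\<exists>c. \<forall>x\<in>S. \<Phi> x = c" if "convex S" "\<And>x. x \<in> S \<Longrightarrow> \<eta> x = 0" for S
  proof -
    have "\<And>x. x \<in> S \<Longrightarrow> (\<Phi> has_vector_derivative 0) (at x within S)"
      using has_vector_derivative_at_within[OF \<Phi>] that(2) by metis
    from has_vector_derivative_zero_constant[OF that(1) this] show ?thesis by metis
  qed
  have "\<exists>c. \<forall>x\<in>{..<s}. \<Phi> x = c" "\<exists>c. \<forall>x\<in>{t<..}. \<Phi> x = c"
    by (rule const; simp add: st)+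
  then obtain c d where cd: "\<And>x. x < s \<Longrightarrow> \<Phi> x = c" "\<And>x. t < x \<Longrightarrow> \<Phi> x = d"
    by (metis greaterThan_iff lessThan_iff)
  moreover have "\<Phi> 0 = 0" by (simp add: \<Phi>_def)
  moreover have "\<Phi> l - \<Phi> 0 = 0"
    using LINT_interval_derivative[of l \<eta> \<Phi>] \<Phi> int0 \<open>0 < l\<close> continuous_on_subset[OF c\<eta>]
    by (auto simp: has_vector_derivative_at_within)
  ultimately have "\<Phi> x = 0" if "x \<notin> {s..t}" for x
    using that st(1,3) cd(1)[of 0] cd(2)[of l] cd(1)[of x] cd(2)[of x] by force
  from test_functionI[OF \<Phi> c\<eta> st(1,3) this] that show ?thesis by blast
qed

text \<open>The bump is the square of the positive part of r^2 - (x - a)^2. Squaring smooths the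
  kinks at a - r and a + r, which is enough because test functions are only required to be
  C1.\<close>

lemma bump_test_function:
  assumes "0 < a - r" and "a + r < l" and "0 < r"
  obtains \<phi> where "test_function l \<phi>" "\<And>x. 0 \<le> \<phi> x" "0 < \<phi> a" "\<And>x. x \<notin> {a-r..a+r} \<Longrightarrow> \<phi> x = 0"
proof -
  define p where "p x = max 0 (r\<^sup>2 - (x - a)\<^sup>2)" for x
  \<comment> \<open>Away from 0 the function agrees locally with 0 or with y^2; at 0 the difference
    quotient is bounded by |h|.\<close>
  have sq: "((\<lambda>y::real. (max 0 y)\<^sup>2) has_real_derivative 2 * max 0 y) (at y)" for y
  proof -
    consider "y < 0" | "y = 0" | "0 < y" by linarith
    then show ?thesis
    proof cases
      case 1
      have "((\<lambda>_. 0) has_real_derivative 0) (at y)" by simp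
      then have "((\<lambda>y::real. (max 0 y)\<^sup>2) has_real_derivative 0) (at y)"
        by (rule DERIV_cong_ev[THEN iffD1, rotated -1])
           (use 1 in \<open>auto intro!: eventually_mono[OF eventually_nhds_in_open[of "{..<0}"]]\<close>)
      with 1 show ?thesis by simp
    next
      case 3
      have "((\<lambda>y. y\<^sup>2) has_real_derivative 2 * y) (at y)" by (auto intro!: derivative_eq_intros)
      then have "((\<lambda>y::real. (max 0 y)\<^sup>2) has_real_derivative 2 * y) (at y)"
        by (rule DERIV_cong_ev[THEN iffD1, rotated -1])
           (use 3 in \<open>auto intro!: eventually_mono[OF eventually_nhds_in_open[of "{0<..}"]]\<close>)
      with 3 show ?thesis by simp
    next
      case 2
      have "((\<lambda>h::real. (max 0 h)\<^sup>2 / h) \<longlongrightarrow> 0) (at 0)"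
      proof (rule Lim_null_comparison)
        show "\<forall>\<^sub>F h in at 0. norm ((max 0 h)\<^sup>2 / h) \<le> \<bar>h\<bar>"
          by (rule always_eventually) (auto simp: max_def power2_eq_square)
        show "((\<lambda>h::real. \<bar>h\<bar>) \<longlongrightarrow> 0) (at 0)"
          by (auto intro!: tendsto_eq_intros)
      qed
      with 2 show ?thesis by (simp add: DERIV_def)
    qed
  qed
  have "((\<lambda>x. r\<^sup>2 - (x - a)\<^sup>2) has_real_derivative - 2 * (x - a)) (at x)" for x
    by (auto intro!: derivative_eq_intros)
  from DERIV_chain2[OF sq this]
  have d: "((\<lambda>x. (p x)\<^sup>2) has_vector_derivative 2 * p x * (- 2 * (x - a))) (at x)" for x
    unfolding p_def has_real_derivative_iff_has_vector_derivative[symmetric] .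
  have cont: "continuous_on UNIV (\<lambda>x. 2 * p x * (- 2 * (x - a)))"
    unfolding p_def by (intro continuous_intros)
  have out: "(p x)\<^sup>2 = 0" if "x \<notin> {a-r..a+r}" for x
  proof -
    have "r < \<bar>x - a\<bar>" using that by auto
    then have "r\<^sup>2 \<le> (x - a)\<^sup>2" using assms(3) by (simp add: abs_le_square_iff[symmetric])
    then show ?thesis by (simp add: p_def)
  qed
  have "test_function l (\<lambda>x. (p x)\<^sup>2)"
    by (rule test_functionI(1)[OF d cont assms(1,2) out])
  moreover have "0 < (p a)\<^sup>2" using assms(3) by (simp add: p_def)
  ultimately show ?thesis using out that[of "\<lambda>x. (p x)\<^sup>2"] by simp
qed

section \<open>Fundamental lemmas of the calculus of variations and the equation - u'' = 1\<close>

lemma LINT_mult_bump_pos: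
  assumes "0 < l" and "continuous_on {0..l} f" and "continuous_on {0..l} \<phi>"
    and "a \<in> {0..l}" and "0 < f a" and "0 < (\<phi> a :: real)"
    and "\<And>x. x \<in> {0..l} \<Longrightarrow> 0 \<le> f x * \<phi> x"
  shows "(LINT x|intv l. f x * \<phi> x) > 0"
proof -
  have c: "continuous_on {0..l} (\<lambda>x. f x * \<phi> x)"
    by (intro continuous_intros assms)
  \<comment> \<open>A nonnegative continuous function with zero integral vanishes everywhere, but
    the product is positive at \<open>a\<close>.\<close>
  have "integral {0..l} (\<lambda>x. f x * \<phi> x) \<noteq> 0"
    using integral_eq_0_iff[OF c assms(1,7)] assms(4-6) by force
  moreover have "integral {0..l} (\<lambda>x. f x * \<phi> x) \<ge> 0"
    using assms(7) by (intro integral_nonneg integrable_continuous_real c) auto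
  ultimately show ?thesis
    by (simp add: LINT_interval_continuous[OF c])
qed

text \<open>
  A test function of zero mean is the derivative of a test function; subtracting from \<open>\<phi>\<close> the multiple
  of a fixed test function with the same integral reduces the claim to this case.
\<close>

lemma weak_derivative_zero:
  assumes "0 < l" and w: "L2_interval l w" and wd: "weak_derivative l w (\<lambda>_. 0)"
  obtains c where "\<And>\<phi>. test_function l \<phi> \<Longrightarrow> (LINT x|intv l. w x * \<phi> x) = c * (LINT x|intv l. \<phi> x)"
proof -
  obtain \<phi>0 where \<phi>0: "test_function l \<phi>0" "\<And>x. 0 \<le> \<phi>0 x" "0 < \<phi>0 (l/2)"
  proof (rule bump_test_function[of "l/2" "l/4" l])
  qed (use \<open>0 < l\<close> in auto)
  have m0: "(LINT x|intv l. \<phi>0 x) > 0"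
    using LINT_mult_bump_pos[of l "\<lambda>_. 1" \<phi>0 "l/2"] \<phi>0 \<open>0 < l\<close>
    by (simp add: test_function_continuous)
  \<comment> \<open>This value is forced: take \<open>\<phi> = \<phi>0\<close> in the claim.\<close>
  define c where "c = (LINT x|intv l. w x * \<phi>0 x) / (LINT x|intv l. \<phi>0 x)"
  have "(LINT x|intv l. w x * \<phi> x) = c * (LINT x|intv l. \<phi> x)" if \<phi>: "test_function l \<phi>" for \<phi>
  proof -
    define k where "k = (LINT x|intv l. \<phi> x) / (LINT x|intv l. \<phi>0 x)"
    define \<eta> where "\<eta> x = \<phi> x - k * \<phi>0 x" for x
    obtain s t s0 t0 where st:
      "0 < s" "t < l" "\<And>x. x \<notin> {s..t} \<Longrightarrow> \<phi> x = 0"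
      "0 < s0" "t0 < l" "\<And>x. x \<notin> {s0..t0} \<Longrightarrow> \<phi>0 x = 0"
      by (rule test_function_support[OF \<phi> \<open>0 < l\<close>], rule test_function_support[OF \<phi>0(1) \<open>0 < l\<close>]) blast
    have "test_function l \<eta>"
    proof (rule test_functionI(1))
      show "(\<eta> has_vector_derivative deriv \<phi> x - k * deriv \<phi>0 x) (at x)" for x
        unfolding \<eta>_def
        by (intro has_vector_derivative_diff has_vector_derivative_mult_right
            test_function_has_deriv[OF \<phi>] test_function_has_deriv[OF \<phi>0(1)])
      show "continuous_on UNIV (\<lambda>x. deriv \<phi> x - k * deriv \<phi>0 x)"
        by (intro continuous_intros test_function_continuous_deriv[OF \<phi>]
            test_function_continuous_deriv[OF \<phi>0(1)])
      \<comment> \<open>The combination is supported in the hull of the two supports, which still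
        keeps a distance from 0 and \<open>l\<close>.\<close>
      show "0 < min s s0" "max t t0 < l" using st by auto
      show "\<eta> x = 0" if "x \<notin> {min s s0..max t t0}" for x
      proof -
        have "x \<notin> {s..t}" "x \<notin> {s0..t0}" using that by auto
        then show ?thesis using st(3,6) by (simp add: \<eta>_def)
      qed
    qed
    moreover have "(LINT x|intv l. \<eta> x) = 0"
    proof -
      have "(LINT x|intv l. \<eta> x) = (LINT x|intv l. \<phi> x) - (LINT x|intv l. k * \<phi>0 x)"
        unfolding \<eta>_def
        by (intro Bochner_Integration.integral_diff integrable_interval_continuous continuous_intros
            test_function_continuous[OF \<phi>] test_function_continuous[OF \<phi>0(1)])
      also have "\<dots> = 0" using m0 by (simp add: k_def)
      finally show ?thesis .
    qed
    ultimately obtain \<Phi> where "test_function l \<Phi>" "deriv \<Phi> = \<eta>"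
      using test_function_primitive[OF \<open>0 < l\<close>] by blast
    with wd have "(LINT x|intv l. w x * \<eta> x) = 0"
      by (auto simp: weak_derivative_def)
    moreover have "(LINT x|intv l. w x * \<eta> x)
        = (LINT x|intv l. w x * \<phi> x) - (LINT x|intv l. k * (w x * \<phi>0 x))"
      unfolding \<eta>_def
      by (subst Bochner_Integration.integral_diff[symmetric])
         (auto intro!: integrable_mult_right L2_interval_integrable_mult w L2_interval_test_function \<phi> \<phi>0
           simp: algebra_simps)
    ultimately show ?thesis using m0 by (simp add: c_def k_def)
  qed
  then show ?thesis using that by blast
qed

text \<open>If the function were nonzero at an interior point, then it or its negative would be
  positive nearby, and pairing with a bump there would give a positive integral. The endpoints
  follow by continuity.\<close>

lemma continuous_LINT_test_zero:
  assumes "0 < l" and f: "continuous_on {0..l} f"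
    and int0: "\<And>\<phi>. test_function l \<phi> \<Longrightarrow> (LINT x|intv l. f x * \<phi> x) = 0"
    and "x \<in> {0..l}"
  shows "f x = (0::real)"
proof -
  have no_pos: False
    if g: "continuous_on {0..l} g" and a: "a \<in> {0<..<l}" "g a > 0"
      and int_g: "\<And>\<phi>. test_function l \<phi> \<Longrightarrow> (LINT x|intv l. g x * \<phi> x) = 0" for a and g :: "real \<Rightarrow> real"
  proof -
    have "a \<in> {0..l}" using a by auto
    with g a(2) obtain d where d: "d > 0" "\<And>y. y \<in> {0..l} \<Longrightarrow> dist y a < d \<Longrightarrow> dist (g y) (g a) < g a"
      unfolding continuous_on_iff by blast
    \<comment> \<open>Half of each available distance: the bump stays inside (0, l) and inside the
      neighbourhood on which \<open>g\<close> is positive.\<close>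
    define r where "r = min (d/2) (min (a/2) ((l-a)/2))"
    have r: "0 < a - r" "a + r < l" "0 < r" "r < d"
      using a d(1) by (auto simp: r_def min_def field_simps)
    obtain \<phi> where \<phi>: "test_function l \<phi>" "\<And>x. 0 \<le> \<phi> x" "0 < \<phi> a" "\<And>x. x \<notin> {a-r..a+r} \<Longrightarrow> \<phi> x = 0"
      using bump_test_function[OF r(1-3)] by blast
    have "0 \<le> g y * \<phi> y" if "y \<in> {0..l}" for y
    proof (cases "y \<in> {a-r..a+r}")
      case True
      then have "dist y a < d" using r by (auto simp: dist_real_def)
      with d(2)[OF that] have "g y > 0" by (auto simp: dist_real_def)
      then show ?thesis using \<phi>(2) by simp
    qed (simp add: \<phi>)
    then have "(LINT x|intv l. g x * \<phi> x) > 0"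
      using a \<open>0 < l\<close> g \<phi>
      by (intro LINT_mult_bump_pos[of l g \<phi> a]) (auto intro: test_function_continuous)
    with int_g[OF \<phi>(1)] show False by simp
  qed
  have "f a = 0" if "a \<in> {0<..<l}" for a
  proof (rule ccontr)
    assume "f a \<noteq> 0"
    then consider "f a > 0" | "- f a > 0" by linarith
    then show False
    proof cases
      case 1
      then show ?thesis using no_pos[OF f that] int0 by blast
    next
      case 2
      then show ?thesis
        using no_pos[OF continuous_on_minus[OF f] that] int0 by simp
    qed
  qed
  then show ?thesis
    using continuous_constant_on_closure[of "{0<..<l}" f 0 x] f assms(1,4) by auto
qed

text \<open>This reduces the weak equation to two numbers per edge. From left to right, the equation
  is integrated twice: each time an explicit polynomial is added to make the weak derivative zero,
  so that the sum is constant when tested. From right to left, the polynomial is differentiated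
  classically.\<close>

lemma H2_second_derivative_neg1_iff:
  assumes "0 < l" and f: "continuous_on {0..l} f"
  shows "H2_second_derivative l f (\<lambda>_. - 1) \<longleftrightarrow>
    (\<forall>x\<in>{0..l}. f x = - x\<^sup>2 / 2 + ((f l - f 0) / l + l / 2) * x + f 0)"
    (is "?L \<longleftrightarrow> ?R")
proof
  assume ?R
  define q where "q x = - x\<^sup>2 / 2 + ((f l - f 0) / l + l / 2) * x + f 0" for x
  define D where "D x = - x + ((f l - f 0) / l + l / 2)" for x
  have L2: "L2_interval l f" "L2_interval l D" "L2_interval l (\<lambda>_. - 1)"
    unfolding D_def by (intro L2_interval_continuous f continuous_intros)+
  have dq: "(q has_vector_derivative D x) (at x within {0..l})" for x
    unfolding q_def D_def has_real_derivative_iff_has_vector_derivative[symmetric]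
    by (auto intro!: derivative_eq_intros)
  have "(f has_vector_derivative D x) (at x within {0..l})" if "x \<in> {0..l}" for x
    by (rule has_vector_derivative_transform[OF that _ dq]) (use \<open>?R\<close> in \<open>unfold q_def, blast\<close>)
  then have "weak_derivative l f D"
    using \<open>0 < l\<close> by (intro weak_derivative_C1) (auto simp: D_def intro!: continuous_intros)
  moreover have "(D has_vector_derivative - 1) (at x within {0..l})" for x
    unfolding D_def has_real_derivative_iff_has_vector_derivative[symmetric]
    by (auto intro!: derivative_eq_intros)
  then have "weak_derivative l D (\<lambda>_. - 1)"
    using \<open>0 < l\<close> by (intro weak_derivative_C1 continuous_on_const) auto
  ultimately show ?L
    using L2 by (auto simp: H2_second_derivative_def)
next
  assume ?L
  then obtain g where g: "L2_interval l g" "weak_derivative l f g" "weak_derivative l g (\<lambda>_. - 1)"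
    by (auto simp: H2_second_derivative_def)
  have add: "weak_derivative l (\<lambda>x. u x + v x) (\<lambda>x. u' x + v' x)"
    if "weak_derivative l u u'" "weak_derivative l v v'" "L2_interval l u" "L2_interval l v"
      "L2_interval l u'" "L2_interval l v'" for u v u' v'
    unfolding weak_derivative_def
  proof (intro allI impI)
    fix \<phi> assume \<phi>: "test_function l \<phi>"
    note [simp] = L2_interval_integrable_mult[OF _ L2_interval_test_function(1)[OF \<phi>]]
      L2_interval_integrable_mult[OF _ L2_interval_test_function(2)[OF \<phi>]]
    show "(LINT x|intv l. (u x + v x) * deriv \<phi> x) = - (LINT x|intv l. (u' x + v' x) * \<phi> x)"
      using that \<phi> by (simp add: distrib_right weak_derivative_def)
  qed
  have L2id: "L2_interval l (\<lambda>x. x)" "L2_interval l (\<lambda>_. a)" for a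
    by (intro L2_interval_continuous continuous_intros)+
  have "weak_derivative l (\<lambda>x. x) (\<lambda>_. 1)"
    using \<open>0 < l\<close> by (intro weak_derivative_C1 continuous_on_const has_vector_derivative_id) simp
  from add[OF g(3) this g(1) L2id(1,2,2)]
  have "weak_derivative l (\<lambda>x. g x + x) (\<lambda>_. 0)" by simp
  then obtain c where c: "\<And>\<phi>. test_function l \<phi> \<Longrightarrow>
      (LINT x|intv l. (g x + x) * \<phi> x) = c * (LINT x|intv l. \<phi> x)"
    using weak_derivative_zero[OF \<open>0 < l\<close> L2_interval_add[OF g(1) L2id(1)]] by blast
  \<comment> \<open>Only integrals of \<open>g\<close> against test functions enter, so
    \<open>g\<close> can be replaced by \<open>c - x\<close> without identifying the two almost
    everywhere.\<close>
  have wf: "weak_derivative l f (\<lambda>x. c - x)"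
    unfolding weak_derivative_def
  proof (intro allI impI)
    fix \<phi> assume \<phi>: "test_function l \<phi>"
    note i = L2_interval_integrable_mult[OF _ L2_interval_test_function(1)[OF \<phi>]]
    have i: "integrable (intv l) (\<lambda>x. g x * \<phi> x)" "integrable (intv l) (\<lambda>x. x * \<phi> x)"
       "integrable (intv l) \<phi>"
      using i[OF g(1)] i[OF L2id(1)] i[OF L2id(2)[of 1]] by simp_all
    have "(LINT x|intv l. g x * \<phi> x) = (LINT x|intv l. (c - x) * \<phi> x)"
      using c[OF \<phi>] i by (simp add: distrib_right left_diff_distrib)
    then show "(LINT x|intv l. f x * deriv \<phi> x) = - (LINT x|intv l. (c - x) * \<phi> x)"
      using g(2) \<phi> by (simp add: weak_derivative_def)
  qed
  \<comment> \<open>A primitive of \<open>x - c\<close>, so that \<open>f + p\<close> has weak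
    derivative zero.\<close>
  define p where "p x = x\<^sup>2 / 2 - c * x" for x
  have cp: "continuous_on {0..l} p" unfolding p_def by (intro continuous_intros) auto
  have "(p has_vector_derivative x - c) (at x within {0..l})" for x
    unfolding p_def has_real_derivative_iff_has_vector_derivative[symmetric]
    by (auto intro!: derivative_eq_intros)
  then have wp: "weak_derivative l p (\<lambda>x. x - c)"
    using \<open>0 < l\<close> by (intro weak_derivative_C1 continuous_intros) auto
  have L2: "L2_interval l f" "L2_interval l p" "L2_interval l (\<lambda>x. c - x)" "L2_interval l (\<lambda>x. x - c)"
    by (intro L2_interval_continuous f cp continuous_intros)+
  have "weak_derivative l (\<lambda>x. f x + p x) (\<lambda>_. 0)"
    using add[OF wf wp L2] by simp
  then obtain b where b: "\<And>\<phi>. test_function l \<phi> \<Longrightarrow>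
      (LINT x|intv l. (f x + p x) * \<phi> x) = b * (LINT x|intv l. \<phi> x)"
    using weak_derivative_zero[OF \<open>0 < l\<close> L2_interval_add[OF L2(1,2)]] by blast
  \<comment> \<open>Continuity of \<open>f\<close> turns the tested identity into one that holds at
    every point, endpoints included.\<close>
  have "f x + p x - b = 0" if "x \<in> {0..l}" for x
  proof (rule continuous_LINT_test_zero[OF \<open>0 < l\<close> _ _ that])
    show "continuous_on {0..l} (\<lambda>x. f x + p x - b)" by (intro continuous_intros f cp)
    fix \<phi> assume \<phi>: "test_function l \<phi>"
    have "(LINT x|intv l. (f x + p x) * \<phi> x - b * \<phi> x) = 0"
      using L2_interval_integrable_mult[OF L2_interval_add[OF L2(1,2)] L2_interval_test_function(1)[OF \<phi>]]
        L2_interval_integrable_mult[OF L2id(2)[of b] L2_interval_test_function(1)[OF \<phi>]]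
      by (subst Bochner_Integration.integral_diff) (simp_all add: b[OF \<phi>])
    then show "(LINT x|intv l. (f x + p x - b) * \<phi> x) = 0"
      by (simp add: left_diff_distrib)
  qed
  then have q: "f x = - x\<^sup>2 / 2 + c * x + b" if "x \<in> {0..l}" for x
    using \<open>\<And>x. x \<in> {0..l} \<Longrightarrow> f x + p x - b = 0\<close>[OF that] by (simp add: p_def)
  \<comment> \<open>Evaluation at the two ends expresses both integration constants by the boundary
    values.\<close>
  have "c = (f l - f 0) / l + l / 2" "f 0 = b"
    using q[of 0] q[of l] \<open>0 < l\<close> by (auto simp: field_simps power2_eq_square)
  then show ?R using q by metis
qed

section \<open>The discrete torsion problem\<close>

text \<open>
  Elimination of one unknown: \<open>B\<close> is the Schur complement of \<open>A k k\<close>, which is again positive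
  definite.
\<close>

lemma positive_definite_solvable:
  fixes A :: "'a \<Rightarrow> 'a \<Rightarrow> real" and b :: "'a \<Rightarrow> real"
  assumes "finite V"
    and "\<And>x. \<exists>i\<in>V. x i \<noteq> 0 \<Longrightarrow> 0 < (\<Sum>i\<in>V. x i * (\<Sum>j\<in>V. A i j * x j))"
  shows "\<exists>x. \<forall>i\<in>V. (\<Sum>j\<in>V. A i j * x j) = b i"
  using assms
proof (induction V arbitrary: A b rule: finite_induct)
  case empty
  show ?case by simp
next
  case (insert k V)
  have upd: "(\<Sum>j\<in>V. A i j * (if j = k then c else x j)) = (\<Sum>j\<in>V. A i j * x j)" for x c i
    using insert.hyps by (intro sum.cong) auto
  \<comment> \<open>The quadratic form at the unit vector of \<open>k\<close> is the pivot, which is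
    therefore positive.\<close>
  have "A k k = (\<Sum>i\<in>insert k V. ((\<lambda>_. 0)(k := 1)) i * (\<Sum>j\<in>insert k V. A i j * ((\<lambda>_. 0)(k := 1)) j))"
    using insert.hyps by (simp add: upd if_distrib[of "\<lambda>a. a * _"] cong: if_cong)
  then have Akk: "0 < A k k"
    using insert.prems[of "(\<lambda>_. 0)(k := 1)"] by simp
  define B where "B i j = A i j - A i k * A k j / A k k" for i j
  have B: "(\<Sum>j\<in>V. B i j * x j) = (\<Sum>j\<in>V. A i j * x j) - A i k * (\<Sum>j\<in>V. A k j * x j) / A k k" for i x
    by (simp add: B_def left_diff_distrib sum_subtractf sum_distrib_left sum_divide_distrib mult.assoc)
  have "0 < (\<Sum>i\<in>V. x i * (\<Sum>j\<in>V. B i j * x j))" if "\<exists>i\<in>V. x i \<noteq> 0" for x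
  proof -
    \<comment> \<open>Chosen so that row \<open>k\<close> of \<open>A y\<close> vanishes; the other
      rows then equal those of \<open>B x\<close>, and positivity passes from \<open>A\<close> to
      \<open>B\<close>.\<close>
    define c where "c = - (\<Sum>j\<in>V. A k j * x j) / A k k"
    define y where "y = x(k := c)"
    have Ay: "(\<Sum>j\<in>insert k V. A i j * y j) = A i k * c + (\<Sum>j\<in>V. A i j * x j)" for i
      using insert.hyps by (simp add: y_def upd)
    have "(\<Sum>j\<in>insert k V. A k j * y j) = 0"
      unfolding Ay using Akk by (simp add: c_def)
    moreover have "(\<Sum>j\<in>insert k V. A i j * y j) = (\<Sum>j\<in>V. B i j * x j)" for i
      unfolding Ay B by (simp add: c_def)
    moreover have "y i = x i" if "i \<in> V" for i
      using that insert.hyps by (auto simp: y_def)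
    ultimately have "(\<Sum>i\<in>insert k V. y i * (\<Sum>j\<in>insert k V. A i j * y j))
        = (\<Sum>i\<in>V. x i * (\<Sum>j\<in>V. B i j * x j))"
      by (subst sum.insert) (use insert.hyps in auto)
    moreover have "\<exists>i\<in>insert k V. y i \<noteq> 0"
      using that insert.hyps by (auto simp: y_def)
    ultimately show ?thesis using insert.prems[of y] by simp
  qed
  then obtain x where x: "\<forall>i\<in>V. (\<Sum>j\<in>V. B i j * x j) = b i - A i k * b k / A k k"
    using insert.IH[of B "\<lambda>i. b i - A i k * b k / A k k"] by blast
  \<comment> \<open>Back substitution: row \<open>k\<close> solved for the eliminated
    unknown.\<close>
  define c where "c = (b k - (\<Sum>j\<in>V. A k j * x j)) / A k k"
  have Ay: "(\<Sum>j\<in>insert k V. A i j * (x(k := c)) j) = A i k * c + (\<Sum>j\<in>V. A i j * x j)" for i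
    using insert.hyps by (simp add: upd)
  have "(\<Sum>j\<in>insert k V. A i j * (x(k := c)) j) = b i" if "i \<in> insert k V" for i
  proof (cases "i = k")
    case True
    then show ?thesis unfolding Ay using Akk by (simp add: c_def)
  next
    case False
    with that x have "(\<Sum>j\<in>V. B i j * x j) = b i - A i k * b k / A k k" by simp
    then show ?thesis unfolding Ay B by (simp add: c_def diff_divide_distrib right_diff_distrib)
  qed
  then show ?case by blast
qed

section \<open>Edge profiles and the weak form on vertex values\<close>

text \<open>The solution of - u'' = 1 on [0, l] with boundary values \<open>p\<close> at 0 and
  \<open>q\<close> at \<open>l\<close>.\<close>

definition edge_profile :: "real \<Rightarrow> real \<Rightarrow> real \<Rightarrow> real \<Rightarrow> real" where
  "edge_profile l p q x = - x\<^sup>2 / 2 + ((q - p) / l + l / 2) * x + p"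

text \<open>The weak form of the vertex conditions, on vertex values.\<close>

definition torsion_potential ::
    "('v, 'e) pre_digraph \<Rightarrow> ('e \<Rightarrow> real) \<Rightarrow> ('v \<Rightarrow> real) \<Rightarrow> ('v \<Rightarrow> real) \<Rightarrow> bool" where
  "torsion_potential G len \<alpha> U \<longleftrightarrow> (\<forall>w.
     (\<Sum>e\<in>arcs G. (U (head G e) - U (tail G e)) * (w (head G e) - w (tail G e)) / len e) +
     (\<Sum>v\<in>verts G. \<alpha> v * U v * w v) =
     (\<Sum>e\<in>arcs G. len e / 2 * (w (tail G e) + w (head G e))))"

definition energy ::
    "('v, 'e) pre_digraph \<Rightarrow> ('e \<Rightarrow> real) \<Rightarrow> ('v \<Rightarrow> real) \<Rightarrow> ('v \<Rightarrow> real) \<Rightarrow> real" where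
  "energy G len \<alpha> U = (\<Sum>e\<in>arcs G. (U (head G e) - U (tail G e))\<^sup>2 / len e) +
     (\<Sum>v\<in>verts G. \<alpha> v * (U v)\<^sup>2)"

text \<open>Connectivity is phrased through functions that do not change along edges. This is what
  vanishing energy delivers, and it passes to the joined graph by composition with the quotient
  map.\<close>

definition connected_graph :: "('v, 'e) pre_digraph \<Rightarrow> bool" where
  "connected_graph G \<longleftrightarrow> (\<forall>f :: 'v \<Rightarrow> real. (\<forall>e\<in>arcs G. f (tail G e) = f (head G e)) \<longrightarrow>
     (\<forall>v\<in>verts G. \<forall>w\<in>verts G. f v = f w))"

lemma edge_profile_ends:
  assumes "l \<noteq> 0"
  shows "edge_profile l p q 0 = p" and "edge_profile l p q l = q"
  using assms by (auto simp: edge_profile_def field_simps power2_eq_square)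

lemma edge_profile_has_derivative:
  "(edge_profile l p q has_vector_derivative (q - p) / l + l / 2 - x) (at x within S)"
  unfolding edge_profile_def has_real_derivative_iff_has_vector_derivative[symmetric]
  by (auto intro!: derivative_eq_intros)

lemma edge_profile_continuous: "continuous_on S (edge_profile l p q)"
  unfolding edge_profile_def by (intro continuous_intros) auto

text \<open>The cubic term depends on the edge length only and thus cancels when two graphs with the
  same edges are compared; the vertex values enter linearly.\<close>

lemma LINT_edge_profile:
  assumes "0 < l"
  shows "(LINT x|lebesgue_on {0..l}. edge_profile l p q x) = l ^ 3 / 12 + l / 2 * (p + q)"
proof -
  define F where "F x = - (x ^ 3) / 6 + ((q - p) / l + l / 2) * x\<^sup>2 / 2 + p * x" for x
  have "(F has_vector_derivative edge_profile l p q x) (at x within {0..l})" for x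
    unfolding F_def edge_profile_def has_real_derivative_iff_has_vector_derivative[symmetric]
    by (auto intro!: derivative_eq_intros)
  then have "(edge_profile l p q has_integral F l - F 0) {0..l}"
    using assms by (intro fundamental_theorem_of_calculus) auto
  moreover have "F l - F 0 = l ^ 3 / 12 + l / 2 * (p + q)"
    using assms by (simp add: F_def field_simps power2_eq_square power3_eq_cube)
  ultimately show ?thesis
    using lebesgue_integral_eq_integral[OF continuous_imp_integrable_real[OF edge_profile_continuous]]
    by (simp add: integral_unique)
qed

text \<open>Each edge is an incoming edge of exactly one vertex, its head. Together with the version
  for tails this converts vertex sums into edge sums, with a loop counted once in each.\<close>

lemma (in fin_digraph) sum_in_arcs:
  "(\<Sum>v\<in>verts G. w v * (\<Sum>e\<in>in_arcs G v. g e)) = (\<Sum>e\<in>arcs G. w (head G e) * (g e :: real))"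
proof -
  have "(\<Sum>v\<in>verts G. \<Sum>e\<in>{e \<in> arcs G. head G e = v}. w (head G e) * g e) = (\<Sum>e\<in>arcs G. w (head G e) * g e)"
    by (intro sum.group) auto
  then show ?thesis
    by (simp add: in_arcs_def sum_distrib_left)
qed

lemma (in fin_digraph) sum_out_arcs:
  "(\<Sum>v\<in>verts G. w v * (\<Sum>e\<in>out_arcs G v. g e)) = (\<Sum>e\<in>arcs G. w (tail G e) * (g e :: real))"
proof -
  have "(\<Sum>v\<in>verts G. \<Sum>e\<in>{e \<in> arcs G. tail G e = v}. w (tail G e) * g e) = (\<Sum>e\<in>arcs G. w (tail G e) * g e)"
    by (intro sum.group) auto
  then show ?thesis
    by (simp add: out_arcs_def sum_distrib_left)
qed

text \<open>A discrete Green formula. The summands on the right are the derivatives of the edge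
  profiles at their two ends, directed into the vertex. Weighting the vertex conditions by
  \<open>w\<close> and summing gives the weak form, and indicator functions recover the single
  conditions.\<close>

lemma (in fin_digraph) torsion_potential_iff:
  "torsion_potential G len \<alpha> U \<longleftrightarrow> (\<forall>v\<in>verts G.
     (\<Sum>e\<in>in_arcs G v. (U (head G e) - U (tail G e)) / len e - len e / 2) +
     (\<Sum>e\<in>out_arcs G v. - ((U (head G e) - U (tail G e)) / len e + len e / 2)) + \<alpha> v * U v = 0)"
proof -
  define inflow where "inflow v = (\<Sum>e\<in>in_arcs G v. (U (head G e) - U (tail G e)) / len e - len e / 2)" for v
  define outflow where "outflow v = (\<Sum>e\<in>out_arcs G v. - ((U (head G e) - U (tail G e)) / len e + len e / 2))" for v
  define R where "R v = inflow v + outflow v + \<alpha> v * U v" for v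
  have weak: "(\<Sum>v\<in>verts G. w v * R v) =
     (\<Sum>e\<in>arcs G. (U (head G e) - U (tail G e)) * (w (head G e) - w (tail G e)) / len e) +
     (\<Sum>v\<in>verts G. \<alpha> v * U v * w v) - (\<Sum>e\<in>arcs G. len e / 2 * (w (tail G e) + w (head G e)))" for w
  proof -
    have "(\<Sum>v\<in>verts G. w v * R v) =
      (\<Sum>v\<in>verts G. w v * inflow v) + (\<Sum>v\<in>verts G. w v * outflow v) + (\<Sum>v\<in>verts G. \<alpha> v * U v * w v)"
      by (simp add: R_def distrib_left sum.distrib mult.commute)
    moreover have "(\<Sum>v\<in>verts G. w v * inflow v) + (\<Sum>v\<in>verts G. w v * outflow v) =
      (\<Sum>e\<in>arcs G. (U (head G e) - U (tail G e)) * (w (head G e) - w (tail G e)) / len e -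
        len e / 2 * (w (tail G e) + w (head G e)))"
      unfolding inflow_def outflow_def sum_in_arcs sum_out_arcs sum.distrib[symmetric]
      by (intro sum.cong refl) (simp add: algebra_simps diff_divide_distrib add_divide_distrib)
    ultimately show ?thesis by (simp add: sum_subtractf)
  qed
  have "torsion_potential G len \<alpha> U \<longleftrightarrow> (\<forall>w. (\<Sum>v\<in>verts G. w v * R v) = 0)"
    unfolding weak torsion_potential_def by simp
  also have "\<dots> \<longleftrightarrow> (\<forall>v\<in>verts G. R v = 0)"
  proof (intro iffI allI ballI)
    fix z assume 0: "\<forall>w. (\<Sum>v\<in>verts G. w v * R v) = 0" and "z \<in> verts G"
    from 0 have "(\<Sum>v\<in>verts G. (if v = z then 1 else 0) * R v) = 0" by (rule spec)
    moreover have "(if v = z then 1 else 0) * R v = (if v = z then R v else 0)" for v by simp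
    ultimately show "R z = 0" using \<open>z \<in> verts G\<close> by (simp add: sum.delta)
  qed simp
  finally show ?thesis by (simp only: R_def inflow_def outflow_def)
qed

lemma (in wf_digraph) torsion_potential_cong:
  assumes "\<And>v. v \<in> verts G \<Longrightarrow> U v = U' v"
  shows "torsion_potential G len \<alpha> U \<longleftrightarrow> torsion_potential G len \<alpha> U'"
  unfolding torsion_potential_def using assms by simp

section \<open>Existence and uniqueness of the discrete solution\<close>

lemma (in metric_graph) energy_nonneg:
  assumes "\<And>v. v \<in> verts G \<Longrightarrow> 0 \<le> \<alpha> v"
  shows "0 \<le> energy G len \<alpha> U"
  unfolding energy_def using assms len_pos
  by (intro add_nonneg_nonneg sum_nonneg) (auto simp: less_imp_le)

text \<open>All summands are nonnegative, hence zero. The edge terms make \<open>U\<close> constant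
  by connectivity, and a vertex with nonzero strength makes the constant zero.\<close>

lemma (in metric_graph) energy_eq_0:
  assumes "connected_graph G" and \<alpha>: "\<And>v. v \<in> verts G \<Longrightarrow> 0 \<le> \<alpha> v" and "\<exists>v\<in>verts G. \<alpha> v \<noteq> 0"
    and 0: "energy G len \<alpha> U = 0" and "v \<in> verts G"
  shows "U v = 0"
proof -
  have nonneg: "0 \<le> (U (head G e) - U (tail G e))\<^sup>2 / len e" if "e \<in> arcs G" for e
    using len_pos[OF that] by simp
  have "(\<Sum>e\<in>arcs G. (U (head G e) - U (tail G e))\<^sup>2 / len e) \<ge> 0"
    "(\<Sum>v\<in>verts G. \<alpha> v * (U v)\<^sup>2) \<ge> 0"
    using \<alpha> nonneg by (intro sum_nonneg; simp)+
  with 0 have "(\<Sum>e\<in>arcs G. (U (head G e) - U (tail G e))\<^sup>2 / len e) = 0"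
    "(\<Sum>v\<in>verts G. \<alpha> v * (U v)\<^sup>2) = 0"
    unfolding energy_def by linarith+
  then have e: "\<forall>e\<in>arcs G. (U (head G e) - U (tail G e))\<^sup>2 / len e = 0"
    and v: "\<forall>v\<in>verts G. \<alpha> v * (U v)\<^sup>2 = 0"
    using \<alpha> nonneg by (simp_all add: sum_nonneg_eq_0_iff)
  have "U (tail G e) = U (head G e)" if "e \<in> arcs G" for e
    using e that len_pos[OF that] by auto
  then have "\<forall>v\<in>verts G. \<forall>w\<in>verts G. U v = U w"
    using assms(1) by (simp add: connected_graph_def)
  moreover obtain z where "z \<in> verts G" "\<alpha> z \<noteq> 0" using assms(3) by blast
  moreover from this v have "U z = 0" by auto
  ultimately show ?thesis using assms(5) by metis
qed

lemma (in metric_graph) torsion_potential_exists: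
  assumes "connected_graph G" and "\<And>v. v \<in> verts G \<Longrightarrow> 0 \<le> \<alpha> v" and "\<exists>v\<in>verts G. \<alpha> v \<noteq> 0"
  obtains U where "torsion_potential G len \<alpha> U"
proof -
  \<comment> \<open>\<open>\<delta> a i\<close> is the indicator function of vertex \<open>i\<close>
    at \<open>a\<close>. Then \<open>A i j\<close> is the energy form evaluated at the indicators of
    \<open>j\<close> and \<open>i\<close>: a weighted graph Laplacian plus the diagonal of
    strengths.\<close>
  define \<delta> where "\<delta> i j = (if j = i then 1 else 0 :: real)" for i j :: 'v
  define K where "K i e = (\<delta> (head G e) i - \<delta> (tail G e) i) / len e" for i e
  define A where "A i j = (\<Sum>e\<in>arcs G. (\<delta> (head G e) j - \<delta> (tail G e) j) * K i e) + \<alpha> i * \<delta> i j" for i j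
  have \<delta>: "(\<Sum>j\<in>verts G. \<delta> i j * x j) = x i" if "i \<in> verts G" for i x
    using that by (simp add: \<delta>_def if_distrib[of "\<lambda>a. a * _"] cong: if_cong)
  have A: "(\<Sum>j\<in>verts G. A i j * x j) = (\<Sum>e\<in>arcs G. (x (head G e) - x (tail G e)) * K i e) + \<alpha> i * x i"
    if "i \<in> verts G" for i x
  proof -
    have "A i j * x j = (\<Sum>e\<in>arcs G. (\<delta> (head G e) j * x j - \<delta> (tail G e) j * x j) * K i e)
        + \<alpha> i * (\<delta> i j * x j)" for j
      unfolding A_def distrib_right sum_distrib_right
      by (intro arg_cong2[of _ _ _ _ "(+)"] sum.cong refl) (simp_all add: algebra_simps)
    then have "(\<Sum>j\<in>verts G. A i j * x j) =
      (\<Sum>j\<in>verts G. \<Sum>e\<in>arcs G. (\<delta> (head G e) j * x j - \<delta> (tail G e) j * x j) * K i e)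
        + \<alpha> i * (\<Sum>j\<in>verts G. \<delta> i j * x j)"
      by (simp add: sum.distrib sum_distrib_left)
    also have "(\<Sum>j\<in>verts G. \<Sum>e\<in>arcs G. (\<delta> (head G e) j * x j - \<delta> (tail G e) j * x j) * K i e) =
      (\<Sum>e\<in>arcs G. (\<Sum>j\<in>verts G. \<delta> (head G e) j * x j - \<delta> (tail G e) j * x j) * K i e)"
      by (subst sum.swap) (simp add: sum_distrib_right)
    finally show ?thesis using that by (simp add: sum_subtractf \<delta>)
  qed
  have xA: "(\<Sum>i\<in>verts G. w i * (\<Sum>j\<in>verts G. A i j * x j)) =
     (\<Sum>e\<in>arcs G. (x (head G e) - x (tail G e)) * (w (head G e) - w (tail G e)) / len e) +
     (\<Sum>v\<in>verts G. \<alpha> v * x v * w v)" for x w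
  proof -
    have "w i * (\<Sum>j\<in>verts G. A i j * x j) = (\<Sum>e\<in>arcs G. (x (head G e) - x (tail G e)) / len e *
        (\<delta> (head G e) i * w i - \<delta> (tail G e) i * w i)) + \<alpha> i * x i * w i" if "i \<in> verts G" for i
      unfolding A[OF that] distrib_left sum_distrib_left
      by (intro arg_cong2[of _ _ _ _ "(+)"] sum.cong refl)
         (simp_all add: K_def algebra_simps diff_divide_distrib add_divide_distrib)
    then have "(\<Sum>i\<in>verts G. w i * (\<Sum>j\<in>verts G. A i j * x j)) =
      (\<Sum>i\<in>verts G. \<Sum>e\<in>arcs G. (x (head G e) - x (tail G e)) / len e *
        (\<delta> (head G e) i * w i - \<delta> (tail G e) i * w i)) + (\<Sum>v\<in>verts G. \<alpha> v * x v * w v)"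
      by (simp add: sum.distrib)
    also have "(\<Sum>i\<in>verts G. \<Sum>e\<in>arcs G. (x (head G e) - x (tail G e)) / len e *
        (\<delta> (head G e) i * w i - \<delta> (tail G e) i * w i)) =
      (\<Sum>e\<in>arcs G. (x (head G e) - x (tail G e)) / len e *
        (\<Sum>i\<in>verts G. \<delta> (head G e) i * w i - \<delta> (tail G e) i * w i))"
      by (subst sum.swap) (simp add: sum_distrib_left)
    finally show ?thesis by (simp add: sum_subtractf \<delta>)
  qed
  have "0 < (\<Sum>i\<in>verts G. x i * (\<Sum>j\<in>verts G. A i j * x j))" if "\<exists>i\<in>verts G. x i \<noteq> 0" for x
  proof -
    have "(\<Sum>i\<in>verts G. x i * (\<Sum>j\<in>verts G. A i j * x j)) = energy G len \<alpha> x"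
      unfolding xA energy_def by (simp add: power2_eq_square mult_ac)
    moreover have "energy G len \<alpha> x \<noteq> 0" using energy_eq_0[OF assms] that by blast
    ultimately show ?thesis using energy_nonneg[of \<alpha> x] assms(2) by simp
  qed
  \<comment> \<open>The right-hand side is the load functional evaluated at the indicator of
    \<open>i\<close>.\<close>
  from positive_definite_solvable[OF finite_verts this,
      of "\<lambda>i. \<Sum>e\<in>arcs G. len e / 2 * (\<delta> (tail G e) i + \<delta> (head G e) i)"]
  obtain U where U: "\<forall>i\<in>verts G. (\<Sum>j\<in>verts G. A i j * U j) =
      (\<Sum>e\<in>arcs G. len e / 2 * (\<delta> (tail G e) i + \<delta> (head G e) i))" by auto
  have "torsion_potential G len \<alpha> U"
    unfolding torsion_potential_def
  proof
    fix w :: "'v \<Rightarrow> real"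
    have "(\<Sum>i\<in>verts G. w i * (\<Sum>j\<in>verts G. A i j * U j)) =
      (\<Sum>i\<in>verts G. \<Sum>e\<in>arcs G. len e / 2 * (\<delta> (tail G e) i * w i + \<delta> (head G e) i * w i))"
    proof (intro sum.cong refl)
      fix i assume "i \<in> verts G"
      with U have "(\<Sum>j\<in>verts G. A i j * U j) = (\<Sum>e\<in>arcs G. len e / 2 * (\<delta> (tail G e) i + \<delta> (head G e) i))"
        by blast
      then show "w i * (\<Sum>j\<in>verts G. A i j * U j) =
          (\<Sum>e\<in>arcs G. len e / 2 * (\<delta> (tail G e) i * w i + \<delta> (head G e) i * w i))"
        by (simp add: sum_distrib_left algebra_simps)
    qed
    also have "\<dots> = (\<Sum>e\<in>arcs G. len e / 2 * (\<Sum>i\<in>verts G. \<delta> (tail G e) i * w i + \<delta> (head G e) i * w i))"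
      by (subst sum.swap) (simp add: sum_distrib_left)
    also have "\<dots> = (\<Sum>e\<in>arcs G. len e / 2 * (w (tail G e) + w (head G e)))"
      by (intro sum.cong refl) (simp add: sum.distrib \<delta>)
    finally show "(\<Sum>e\<in>arcs G. (U (head G e) - U (tail G e)) * (w (head G e) - w (tail G e)) / len e) +
       (\<Sum>v\<in>verts G. \<alpha> v * U v * w v) = (\<Sum>e\<in>arcs G. len e / 2 * (w (tail G e) + w (head G e)))"
      unfolding xA .
  qed
  then show ?thesis using that by blast
qed

text \<open>Testing both weak equations with the difference of the two solutions shows that the
  difference has zero energy.\<close>

lemma (in metric_graph) torsion_potential_unique:
  assumes "connected_graph G" and "\<And>v. v \<in> verts G \<Longrightarrow> 0 \<le> \<alpha> v" and "\<exists>v\<in>verts G. \<alpha> v \<noteq> 0"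
    and U: "torsion_potential G len \<alpha> U" and U': "torsion_potential G len \<alpha> U'" and "v \<in> verts G"
  shows "U v = U' v"
proof -
  define w where "w v = U v - U' v" for v
  have "energy G len \<alpha> w =
    ((\<Sum>e\<in>arcs G. (U (head G e) - U (tail G e)) * (w (head G e) - w (tail G e)) / len e) +
     (\<Sum>v\<in>verts G. \<alpha> v * U v * w v)) -
    ((\<Sum>e\<in>arcs G. (U' (head G e) - U' (tail G e)) * (w (head G e) - w (tail G e)) / len e) +
     (\<Sum>v\<in>verts G. \<alpha> v * U' v * w v))"
    unfolding energy_def add_diff_add sum_subtractf[symmetric]
    by (intro arg_cong2[of _ _ _ _ "(+)"] sum.cong refl)
       (simp_all add: w_def power2_eq_square divide_inverse algebra_simps)
  also have "\<dots> = 0" using U U' unfolding torsion_potential_def by simp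
  finally have "w v = 0" using energy_eq_0[OF assms(1-3)] \<open>v \<in> verts G\<close> by blast
  then show ?thesis by (simp add: w_def)
qed

section \<open>The torsion function\<close>

lemma (in metric_graph) edge_point_ends:
  assumes "e \<in> arcs G"
  shows "edge_point G len e 0 = Inl (tail G e)" and "edge_point G len e (len e) = Inl (head G e)"
  using len_pos[OF assms] by (auto simp: edge_point_def)

lemma (in metric_graph) edge_point_in_mg_points:
  assumes "e \<in> arcs G" and "x \<in> {0..len e}"
  shows "edge_point G len e x \<in> mg_points G len"
  unfolding mg_points_def using assms by blast

text \<open>The universal property of the quotient topology: openness of a preimage is tested on
  each edge separately.\<close>

lemma (in metric_graph) continuous_map_mg_topology_iff:
  "continuous_map (mg_topology G len) euclideanreal u \<longleftrightarrow>
     (\<forall>e\<in>arcs G. continuous_on {0..len e} (u \<circ> edge_point G len e))"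
proof -
  have "{x \<in> {0..len e}. edge_point G len e x \<in> {p \<in> mg_points G len. u p \<in> T}} =
      {x \<in> {0..len e}. (u \<circ> edge_point G len e) x \<in> T}" if "e \<in> arcs G" for e T
    using edge_point_in_mg_points[OF that] by auto
  then have "continuous_map (mg_topology G len) euclideanreal u \<longleftrightarrow>
     (\<forall>e\<in>arcs G. continuous_map (top_of_set {0..len e}) euclideanreal (u \<circ> edge_point G len e))"
    unfolding continuous_map_def openin_mg_topology topspace_mg_topology by auto
  then show ?thesis by simp
qed

lemma (in metric_graph) connected_graph_if_mg_connected:
  assumes "mg_connected G len"
  shows "connected_graph G"
  unfolding connected_graph_def
proof (intro allI impI ballI)
  fix f :: "'v \<Rightarrow> real" and v w
  assume f: "\<forall>e\<in>arcs G. f (tail G e) = f (head G e)" and vw: "v \<in> verts G" "w \<in> verts G"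
  \<comment> \<open>\<open>f\<close> extended to be constant along every edge; the value at the tail
    is also the one at the head.\<close>
  define F where "F p = (case p of Inl v \<Rightarrow> f v | Inr (e, x) \<Rightarrow> f (tail G e))" for p :: "'v + 'e \<times> real"
  have F: "F (edge_point G len e x) = f (tail G e)" if "e \<in> arcs G" for e x
    using f that by (auto simp: F_def edge_point_def)
  have op: "openin (mg_topology G len) {p \<in> mg_points G len. F p \<in> B}" for B
  proof -
    \<comment> \<open>Each edge lies entirely inside or entirely outside a preimage under
      \<open>F\<close>. So all preimages are open, level sets are clopen, and connectedness makes
      \<open>F\<close> constant.\<close>
    have "{x \<in> {0..len e}. edge_point G len e x \<in> {p \<in> mg_points G len. F p \<in> B}} =
      (if f (tail G e) \<in> B then {0..len e} else {})" if "e \<in> arcs G" for e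
      using F[OF that] edge_point_in_mg_points[OF that] by auto
    then show ?thesis by (auto simp: openin_mg_topology)
  qed
  have "mg_points G len - {p \<in> mg_points G len. F p \<in> {f v}} = {p \<in> mg_points G len. F p \<in> - {f v}}"
    by auto
  then have "closedin (mg_topology G len) {p \<in> mg_points G len. F p \<in> {f v}}"
    using op[of "- {f v}"] by (auto simp: closedin_def topspace_mg_topology)
  moreover have "connected_space (mg_topology G len)"
    using assms path_connected_imp_connected_space by (auto simp: mg_connected_def)
  moreover have "Inl v \<in> {p \<in> mg_points G len. F p \<in> {f v}}"
    using vw by (auto simp: mg_points_def F_def)
  ultimately have "{p \<in> mg_points G len. F p \<in> {f v}} = mg_points G len"
    using op[of "{f v}"] unfolding connected_space_clopen_in topspace_mg_topology by blast
  moreover have "Inl w \<in> mg_points G len" using vw by (auto simp: mg_points_def)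
  ultimately have "F (Inl w) = f v" by blast
  then show "f v = f w" by (simp add: F_def)
qed

lemma (in metric_graph) vector_derivative_edge_profile:
  assumes e: "e \<in> arcs G" and "x \<in> {0..len e}"
    and u: "\<And>x. x \<in> {0..len e} \<Longrightarrow> u (edge_point G len e x) = edge_profile (len e) p q x"
  shows "vector_derivative (u \<circ> edge_point G len e) (at x within {0..len e}) = (q - p) / len e + len e / 2 - x"
proof (rule vector_derivative_within_closed_interval)
  show "(u \<circ> edge_point G len e has_vector_derivative (q - p) / len e + len e / 2 - x) (at x within {0..len e})"
    by (rule has_vector_derivative_transform[OF _ _ edge_profile_has_derivative]) (use assms in auto)
qed (use assms len_pos[OF e] in auto)

text \<open>The torsion problem becomes finite-dimensional: on each edge the function is the profile
  of its end values, and the vertex conditions become the discrete equation for those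
  values.\<close>

lemma (in metric_graph) neg_laplacian_one_iff:
  "neg_laplacian G len \<alpha> u (\<lambda>_. 1) \<longleftrightarrow>
    (\<forall>e\<in>arcs G. \<forall>x\<in>{0..len e}. u (edge_point G len e x) =
       edge_profile (len e) (u (Inl (tail G e))) (u (Inl (head G e))) x) \<and>
    torsion_potential G len \<alpha> (\<lambda>v. u (Inl v))"
proof -
  define profile where "profile \<longleftrightarrow> (\<forall>e\<in>arcs G. \<forall>x\<in>{0..len e}. u (edge_point G len e x) =
       edge_profile (len e) (u (Inl (tail G e))) (u (Inl (head G e))) x)"
  have H2: "H2_second_derivative (len e) (u \<circ> edge_point G len e) (\<lambda>_. - 1) \<longleftrightarrow>
      (\<forall>x\<in>{0..len e}. u (edge_point G len e x) =
       edge_profile (len e) (u (Inl (tail G e))) (u (Inl (head G e))) x)"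
    if "e \<in> arcs G" "continuous_on {0..len e} (u \<circ> edge_point G len e)" for e
    using H2_second_derivative_neg1_iff[OF len_pos[OF that(1)] that(2)]
    by (simp add: edge_point_ends[OF that(1)] edge_profile_def)
  \<comment> \<open>The interval characterization presupposes continuity, which the polynomial form
    on each edge supplies.\<close>
  have cont: "continuous_on {0..len e} (u \<circ> edge_point G len e)" if profile "e \<in> arcs G" for e
    using that by (subst continuous_on_cong[OF refl, of _ _ "edge_profile (len e) (u (Inl (tail G e))) (u (Inl (head G e)))"])
      (auto simp: profile_def edge_profile_continuous)
  have nds: "normal_derivative_sum G len u v =
     (\<Sum>e\<in>in_arcs G v. (u (Inl (head G e)) - u (Inl (tail G e))) / len e - len e / 2) +
     (\<Sum>e\<in>out_arcs G v. - ((u (Inl (head G e)) - u (Inl (tail G e))) / len e + len e / 2))" if profile for v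
  proof -
    have "vector_derivative (u \<circ> edge_point G len e) (at x within {0..len e}) =
        (u (Inl (head G e)) - u (Inl (tail G e))) / len e + len e / 2 - x"
      if "e \<in> arcs G" "x \<in> {0..len e}" for e x
      using vector_derivative_edge_profile[OF that] \<open>profile\<close> that by (auto simp: profile_def)
    then show ?thesis
      unfolding normal_derivative_sum_def using len_pos
      by (intro arg_cong2[of _ _ _ _ "(+)"] sum.cong refl) (auto simp: less_imp_le)
  qed
  have "(\<forall>e\<in>arcs G. continuous_on {0..len e} (u \<circ> edge_point G len e) \<and>
      H2_second_derivative (len e) (u \<circ> edge_point G len e) (\<lambda>_. - 1)) \<longleftrightarrow> profile" (is "?L \<longleftrightarrow> _")
  proof
    assume ?L
    then show profile using H2 unfolding profile_def by blast
  next
    assume profile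
    then show ?L using H2 cont[OF \<open>profile\<close>] unfolding profile_def by blast
  qed
  moreover have "neg_laplacian G len \<alpha> u (\<lambda>_. 1) \<longleftrightarrow> ?L \<and>
      (\<forall>v\<in>verts G. normal_derivative_sum G len u v + \<alpha> v * u (Inl v) = 0)"
    unfolding neg_laplacian_def laplacian_domain_def continuous_map_mg_topology_iff H2_interval_def
      mem_Collect_eq by blast
  ultimately have "neg_laplacian G len \<alpha> u (\<lambda>_. 1) \<longleftrightarrow> profile \<and>
      (\<forall>v\<in>verts G. normal_derivative_sum G len u v + \<alpha> v * u (Inl v) = 0)"
    by simp
  then show ?thesis
    unfolding torsion_potential_iff profile_def[symmetric] using nds by auto
qed

text \<open>Gluing the edge profiles of \<open>U\<close> gives a solution, and uniqueness of the
  vertex values makes it the only extensional one, so the description operator returns it. The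
  formula is then the sum of the profile integrals.\<close>

lemma (in metric_graph) torsional_rigidity_eq:
  assumes "connected_graph G" and "\<And>v. v \<in> verts G \<Longrightarrow> 0 \<le> \<alpha> v" and "\<exists>v\<in>verts G. \<alpha> v \<noteq> 0"
    and U: "torsion_potential G len \<alpha> U"
  shows "torsional_rigidity G len \<alpha> =
    (\<Sum>e\<in>arcs G. len e ^ 3 / 12 + len e / 2 * (U (tail G e) + U (head G e)))"
proof -
  define u where "u = restrict (\<lambda>p. case p of Inl v \<Rightarrow> U v |
      Inr (e, x) \<Rightarrow> edge_profile (len e) (U (tail G e)) (U (head G e)) x) (mg_points G len)"
  have Inl: "Inl v \<in> mg_points G len" if "v \<in> verts G" for v
    using that by (auto simp: mg_points_def)
  have uInl: "u (Inl v) = U v" if "v \<in> verts G" for v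
    using Inl[OF that] by (simp add: u_def)
  have u_edge: "u (edge_point G len e x) = edge_profile (len e) (U (tail G e)) (U (head G e)) x"
    if "e \<in> arcs G" "x \<in> {0..len e}" for e x
    using edge_point_in_mg_points[OF that] len_pos[OF that(1)]
    by (auto simp: u_def edge_point_def edge_profile_ends)
  have "torsion_function G len \<alpha> = u"
    unfolding torsion_function_def
  proof (rule the_equality)
    have "torsion_potential G len \<alpha> (\<lambda>v. u (Inl v))"
      using U by (subst torsion_potential_cong[of _ U]) (auto simp: uInl)
    then show "u \<in> extensional (mg_points G len) \<and> neg_laplacian G len \<alpha> u (\<lambda>_. 1)"
      unfolding neg_laplacian_one_iff by (auto simp: u_edge uInl) (simp add: u_def)
  next
    fix u' assume u': "u' \<in> extensional (mg_points G len) \<and> neg_laplacian G len \<alpha> u' (\<lambda>_. 1)"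
    then have "torsion_potential G len \<alpha> (\<lambda>v. u' (Inl v))" and
      edge': "\<And>e x. e \<in> arcs G \<Longrightarrow> x \<in> {0..len e} \<Longrightarrow> u' (edge_point G len e x) =
         edge_profile (len e) (u' (Inl (tail G e))) (u' (Inl (head G e))) x"
      unfolding neg_laplacian_one_iff by blast+
    then have Inl': "u' (Inl v) = U v" if "v \<in> verts G" for v
      using torsion_potential_unique[OF assms(1-3) _ U that] by blast
    show "u' = u"
    proof (rule extensionalityI)
      fix p assume "p \<in> mg_points G len"
      then show "u' p = u p"
        unfolding mg_points_def using Inl' uInl edge' u_edge by auto
    qed (use u' in \<open>auto simp: u_def\<close>)
  qed
  moreover have "(LINT x|lebesgue_on {0..len e}. u (edge_point G len e x)) =
      len e ^ 3 / 12 + len e / 2 * (U (tail G e) + U (head G e))" if "e \<in> arcs G" for e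
  proof -
    have "(LINT x|lebesgue_on {0..len e}. u (edge_point G len e x)) =
        (LINT x|lebesgue_on {0..len e}. edge_profile (len e) (U (tail G e)) (U (head G e)) x)"
      using u_edge[OF that] by (intro Bochner_Integration.integral_cong) auto
    then show ?thesis using LINT_edge_profile[OF len_pos[OF that]] by simp
  qed
  ultimately show ?thesis
    by (simp add: torsional_rigidity_def mg_integral_def)
qed

section \<open>Comparison of the rigidities before and after joining\<close>

theorem theorem7p3:
  fixes G :: "('v, 'e) pre_digraph"
    and len :: "'e \<Rightarrow> real"
    and \<alpha> \<alpha>' :: "'v \<Rightarrow> real"
    and v0 v1 v2 :: 'v
  assumes "metric_graph G len"
    and "mg_connected G len"
    and "\<forall>v\<in>verts G. 0 \<le> \<alpha> v"
    and "\<exists>v\<in>verts G. \<alpha> v \<noteq> 0"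
    and "v1 \<in> verts G" and "v2 \<in> verts G" and "v1 \<noteq> v2"
    and "v0 \<notin> verts G - {v1, v2}"
    and "\<alpha>' v0 = \<alpha> v1 + \<alpha> v2"
    and "\<forall>v\<in>verts G - {v1, v2}. \<alpha>' v = \<alpha> v"
  shows "torsional_rigidity (join_vertices v1 v2 v0 G) len \<alpha>' \<le> torsional_rigidity G len \<alpha>"
proof -
  interpret G: metric_graph G len by fact
  define q where "q v = (if v \<in> {v1, v2} then v0 else v)" for v
  define G' where "G' = join_vertices v1 v2 v0 G"
  have G': "arcs G' = arcs G" "verts G' = q ` verts G"
    "tail G' e = q (tail G e)" "head G' e = q (head G e)" for e
    by (simp_all add: G'_def join_vertices_def q_def Let_def)
  interpret G': metric_graph G' len
    by unfold_locales (auto simp: G' G.len_pos)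
  \<comment> \<open>The vertices untouched by the joining. The name \<open>v0\<close> may coincide
    with \<open>v1\<close> or \<open>v2\<close>, but it never lies in \<open>R\<close>.\<close>
  define R where "R = verts G - {v1, v2}"
  have R: "finite R" "v1 \<notin> R" "v2 \<notin> R" "v0 \<notin> R" "verts G = insert v1 (insert v2 R)"
    using assms(5-8) by (auto simp: R_def)
  have qR: "q v = v" if "v \<in> R" for v using that by (auto simp: q_def R_def)
  have verts': "verts G' = insert v0 R"
    unfolding G'(2) R(5) using qR by (simp add: q_def[of v1] q_def[of v2] cong: image_cong)
  have \<alpha>R: "\<alpha>' v = \<alpha> v" if "v \<in> R" for v using that assms(10) by (simp add: R_def)
  \<comment> \<open>Change of variables along \<open>q\<close>: the fibre over \<open>v0\<close>
    consists of \<open>v1\<close> and \<open>v2\<close>, whose strengths add up, and all other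
    fibres are single vertices. This is where the choice of strength at \<open>v0\<close>
    enters.\<close>
  have sum_\<alpha>: "(\<Sum>v\<in>verts G'. \<alpha>' v * g v) = (\<Sum>v\<in>verts G. \<alpha> v * g (q v))" for g
  proof -
    have "(\<Sum>v\<in>R. \<alpha>' v * g v) = (\<Sum>v\<in>R. \<alpha> v * g (q v))"
      by (intro sum.cong refl) (simp add: qR \<alpha>R)
    then show ?thesis
      unfolding verts' R(5) using R(1-4) \<open>v1 \<noteq> v2\<close> assms(9)
      by (simp add: q_def[of v1] q_def[of v2] distrib_right)
  qed
  have conn: "connected_graph G"
    using assms(2) by (rule G.connected_graph_if_mg_connected)
  have conn': "connected_graph G'"
    unfolding connected_graph_def
  proof (intro allI impI)
    fix f :: "'v \<Rightarrow> real" assume "\<forall>e\<in>arcs G'. f (tail G' e) = f (head G' e)"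
    then have "\<forall>e\<in>arcs G. (f \<circ> q) (tail G e) = (f \<circ> q) (head G e)" by (simp add: G')
    with conn have "\<forall>v\<in>verts G. \<forall>w\<in>verts G. (f \<circ> q) v = (f \<circ> q) w"
      unfolding connected_graph_def by blast
    then show "\<forall>v\<in>verts G'. \<forall>w\<in>verts G'. f v = f w"
      unfolding G'(2) comp_def by blast
  qed
  have \<alpha>: "\<And>v. v \<in> verts G \<Longrightarrow> 0 \<le> \<alpha> v" using assms(3) by blast
  have \<alpha>': "0 \<le> \<alpha>' v" if "v \<in> verts G'" for v
    using that \<alpha> \<alpha>R assms(9) R(5) by (auto simp: verts')
  \<comment> \<open>By nonnegativity, a zero sum at \<open>v0\<close> means that both summands
    vanish, so the nonzero strength sits in \<open>R\<close>.\<close>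
  have \<alpha>'_nz: "\<exists>v\<in>verts G'. \<alpha>' v \<noteq> 0"
  proof (cases "\<alpha>' v0 = 0")
    case True
    then have "\<alpha> v1 = 0" "\<alpha> v2 = 0" using assms(9) \<alpha>[OF assms(5)] \<alpha>[OF assms(6)] by linarith+
    then show ?thesis using assms(4) \<alpha>R R(5) by (auto simp: verts')
  qed (auto simp: verts')
  obtain U where U: "torsion_potential G len \<alpha> U"
    using G.torsion_potential_exists[OF conn \<alpha> assms(4)] .
  obtain U' where U': "torsion_potential G' len \<alpha>' U'"
    using G'.torsion_potential_exists[OF conn' \<alpha>' \<alpha>'_nz] .
  define W where "W v = U' (q v)" for v
  define load where "load w = (\<Sum>e\<in>arcs G. len e / 2 * (w (tail G e) + w (head G e)))" for w
  have UU: "energy G len \<alpha> U = load U"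
    using U[unfolded torsion_potential_def, rule_format, of U]
    by (simp add: energy_def load_def power2_eq_square mult_ac)
  \<comment> \<open>The pullback \<open>W\<close> is an admissible test function on the unjoined
    graph, whose test functions need not agree at \<open>v1\<close> and \<open>v2\<close>.\<close>
  have UW: "(\<Sum>e\<in>arcs G. (U (head G e) - U (tail G e)) * (W (head G e) - W (tail G e)) / len e) +
     (\<Sum>v\<in>verts G. \<alpha> v * U v * W v) = load W"
    using U[unfolded torsion_potential_def, rule_format, of W] by (simp add: load_def)
  \<comment> \<open>\<open>W\<close> need not solve the problem on \<open>G\<close>. It satisfies
    only this energy identity, which is the joined equation tested with \<open>U'\<close> itself and
    pulled back along \<open>q\<close>.\<close>
  have WW: "energy G len \<alpha> W = load W"
  proof -
    have "(\<Sum>v\<in>verts G'. \<alpha>' v * (U' v * U' v)) = (\<Sum>v\<in>verts G. \<alpha> v * (W v * W v))"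
      by (simp add: sum_\<alpha> W_def)
    then show ?thesis
      using U'[unfolded torsion_potential_def, rule_format, of U']
      by (simp add: energy_def load_def power2_eq_square mult.assoc W_def G'(1,3,4))
  qed
  \<comment> \<open>Expansion of the quadratic form at a difference; the three identities above
    reduce it to the difference of the loads.\<close>
  have "energy G len \<alpha> (\<lambda>v. U v - W v) = energy G len \<alpha> U + energy G len \<alpha> W -
    2 * ((\<Sum>e\<in>arcs G. (U (head G e) - U (tail G e)) * (W (head G e) - W (tail G e)) / len e) +
     (\<Sum>v\<in>verts G. \<alpha> v * U v * W v))"
  proof -
    have "energy G len \<alpha> U + energy G len \<alpha> W -
      2 * ((\<Sum>e\<in>arcs G. (U (head G e) - U (tail G e)) * (W (head G e) - W (tail G e)) / len e) +
       (\<Sum>v\<in>verts G. \<alpha> v * U v * W v)) =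
      (\<Sum>e\<in>arcs G. (U (head G e) - U (tail G e))\<^sup>2 / len e + (W (head G e) - W (tail G e))\<^sup>2 / len e
        - 2 * ((U (head G e) - U (tail G e)) * (W (head G e) - W (tail G e)) / len e)) +
      (\<Sum>v\<in>verts G. \<alpha> v * (U v)\<^sup>2 + \<alpha> v * (W v)\<^sup>2 - 2 * (\<alpha> v * U v * W v))"
      unfolding energy_def sum.distrib sum_subtractf sum_distrib_left[symmetric] by (simp add: algebra_simps)
    also have "\<dots> = energy G len \<alpha> (\<lambda>v. U v - W v)"
      unfolding energy_def
      by (intro arg_cong2[of _ _ _ _ "(+)"] sum.cong refl)
         (simp_all add: power2_eq_square divide_inverse algebra_simps)
    finally show ?thesis by simp
  qed
  also have "\<dots> = load U - load W"
    unfolding UU WW UW by simp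
  finally have "load W \<le> load U"
    using G.energy_nonneg[of \<alpha> "\<lambda>v. U v - W v"] \<alpha> by simp
  moreover have "torsional_rigidity G len \<alpha> = (\<Sum>e\<in>arcs G. len e ^ 3 / 12) + load U"
    using G.torsional_rigidity_eq[OF conn \<alpha> assms(4) U] by (simp add: load_def sum.distrib)
  moreover have "torsional_rigidity G' len \<alpha>' = (\<Sum>e\<in>arcs G. len e ^ 3 / 12) + load W"
    using G'.torsional_rigidity_eq[OF conn' \<alpha>' \<alpha>'_nz U']
    by (simp add: load_def sum.distrib G'(1,3,4) W_def)
  ultimately show ?thesis by (simp add: G'_def)
qed

end
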